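(* Let $G$ be a countable ICC group and let $\pi:G\to\mathcal U(\mathcal H)$ be a unitary representation of $G$ on the Hilbert space $\mathcal H$. Let $\xi_1\in\mathcal H$ be a Parseval frame vector for $\mathcal H$, $\mathcal H\neq\{0\}$, let $N:=\lfloor 1/\|\xi_1\|^2\rfloor$, and let $\xi_1,\dots,\xi_{N+1}\in\mathcal H$ be a strongly disjoint $(N+1)$-tuple of Parseval frame vectors such that $\xi_1,\dots,\xi_N$ are Parseval frame vectors for $\mathcal H$, $\|\xi_{N+1}\|^2=1-N\|\xi_1\|^2$, and $\xi_{N+1}$ is a Parseval frame vector for $p_r'\mathcal H$, where $p_r'\in\pi(G)'$ is a projection. Let $\eta\in\mathcal H$ be another Parseval frame vector for a subspace of $\mathcal H$, and let $q'$ be the projection onto this subspace. Then there exist unique $u_i'\in\pi(G)'$, $i=1,\dots,N+1$, with $q'u_i'=u_i'$ for $i=1,\dots,N+1$ and $u_{N+1}'p_r'=u_{N+1}'$, such that $$\eta=u_1'\xi_1+\dots+u_{N+1}'\xi_{N+1}.\qquad( * )$$ Moreover $$\sum_{i=1}^{N+1}u_i'u_i'^*=q'.\qquad( ** )$$ Conversely, let $q'\in\pi(G)'$ be a projection. If the vector $\eta$ is defined by $( * )$ with $u_i'\in\pi(G)'$, $q'u_i'=u_i'$ for $i=1,\dots,N+1$, and $u_{N+1}'p_r'=u_{N+1}'$, satisfying $( ** )$, then $\eta$ is a Parseval frame vector for $q'\mathcal H$.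
   Context: A group $G$ is ICC if for every $g\ne e$ in $G$ the conjugacy class of $g$ is infinite. A family $\{e_i\,|\,i\in I\}$ in a Hilbert space $\mathcal K$ is a Parseval frame for $\mathcal K$ if $\|f\|^2=\sum_{i\in I}|\langle f,e_i\rangle|^2$ for all $f\in\mathcal K$. A vector $\xi\in\mathcal H$ is a Parseval frame vector for a closed subspace $\mathcal K\subseteq\mathcal H$ (possibly $\mathcal K=\mathcal H$) if $\{\pi(g)\xi\,|\,g\in G\}$ (indexed by $G$) is contained in $\mathcal K$ and is a Parseval frame for $\mathcal K$ (so $\mathcal K$ is its closed linear span). Parseval frames $\{e_i^1\},\dots,\{e_i^n\}$ ($i\in I$) for Hilbert spaces $\mathcal H_1,\dots,\mathcal H_n$ form a strongly disjoint $n$-tuple if $\{e_i^1\oplus\dots\oplus e_i^n\,|\,i\in I\}$ is a Parseval frame for $\mathcal H_1\oplus\dots\oplus\mathcal H_n$; Parseval frame vectors form a strongly disjoint $n$-tuple if the frames indexed by $G$ which they generate do. $\pi(G)'$ is the commutant of $\pi(G)$. "Projection" means orthogonal projection. *)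

theory Defs
  imports "HOL-Analysis.Analysis" "HOL-Algebra.Group"
begin

section \<open>Complex Hilbert spaces and operators\<close>

text \<open>
  The inner product is linear in the first argument. The last axiom makes it positive definite and
  ties it to the norm, with respect to which the space is complete.
\<close>

class chilbert = banach +
  fixes scaleC :: "complex \<Rightarrow> 'a \<Rightarrow> 'a" (infixr "*\<^sub>C" 75)
    and cinner :: "'a \<Rightarrow> 'a \<Rightarrow> complex"
  assumes scaleC_add_right: "c *\<^sub>C (x + y) = c *\<^sub>C x + c *\<^sub>C y"
    and scaleC_add_left: "(c + d) *\<^sub>C x = c *\<^sub>C x + d *\<^sub>C x"
    and scaleC_scaleC: "c *\<^sub>C (d *\<^sub>C x) = (c * d) *\<^sub>C x"
    and scaleC_of_real: "complex_of_real r *\<^sub>C x = r *\<^sub>R x"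
    and cinner_commute: "cinner x y = cnj (cinner y x)"
    and cinner_add_left: "cinner (x + y) z = cinner x z + cinner y z"
    and cinner_scaleC_left: "cinner (c *\<^sub>C x) y = c * cinner x y"
    and cinner_self: "cinner x x = complex_of_real ((norm x)\<^sup>2)"

instantiation complex :: chilbert
begin

definition "scaleC_complex (c :: complex) (x :: complex) = c * x"
definition "cinner_complex (x :: complex) (y :: complex) = x * cnj y"

instance
proof
  fix c d x y z :: complex and r :: real
  show "c *\<^sub>C (x + y) = c *\<^sub>C x + c *\<^sub>C y"
    and "(c + d) *\<^sub>C x = c *\<^sub>C x + d *\<^sub>C x"
    and "c *\<^sub>C (d *\<^sub>C x) = (c * d) *\<^sub>C x"
    and "complex_of_real r *\<^sub>C x = r *\<^sub>R x"
    by (simp_all add: scaleC_complex_def distrib_left distrib_right scaleR_conv_of_real)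
  show "cinner x y = cnj (cinner y x)"
    and "cinner (x + y) z = cinner x z + cinner y z"
    and "cinner (c *\<^sub>C x) y = c * cinner x y"
    by (simp_all add: cinner_complex_def scaleC_complex_def distrib_right)
  show "cinner x x = complex_of_real ((norm x)\<^sup>2)"
    unfolding cinner_complex_def by (rule complex_norm_square [symmetric])
qed

end

definition closed_csubspace :: "'h::chilbert set \<Rightarrow> bool" where
  "closed_csubspace K \<longleftrightarrow> closed K \<and> 0 \<in> K \<and> (\<forall>x\<in>K. \<forall>y\<in>K. x + y \<in> K) \<and>
     (\<forall>c. \<forall>x\<in>K. c *\<^sub>C x \<in> K)"

definition bounded_clinear :: "('h::chilbert \<Rightarrow> 'h) \<Rightarrow> bool" where
  "bounded_clinear T \<longleftrightarrow> bounded_linear T \<and> (\<forall>c x. T (c *\<^sub>C x) = c *\<^sub>C T x)"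

text \<open>For bounded \<open>T\<close> the adjoint exists by the Riesz representation theorem.\<close>

definition cadjoint :: "('h::chilbert \<Rightarrow> 'h) \<Rightarrow> 'h \<Rightarrow> 'h" where
  "cadjoint T = (THE S. \<forall>x y. cinner (T x) y = cinner x (S y))"

definition is_projection :: "('h::chilbert \<Rightarrow> 'h) \<Rightarrow> bool" where
  "is_projection p \<longleftrightarrow> bounded_clinear p \<and> p \<circ> p = p \<and>
     (\<forall>x y. cinner (p x) y = cinner x (p y))"

definition commutant :: "('h::chilbert \<Rightarrow> 'h) set \<Rightarrow> ('h \<Rightarrow> 'h) set" where
  "commutant S = {T. bounded_clinear T \<and> (\<forall>A\<in>S. T \<circ> A = A \<circ> T)}"

definition unitary_op :: "('h::chilbert \<Rightarrow> 'h) \<Rightarrow> bool" where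
  "unitary_op U \<longleftrightarrow> bounded_clinear U \<and> surj U \<and>
     (\<forall>x y. cinner (U x) (U y) = cinner x y)"

definition unitary_group :: "('h::chilbert \<Rightarrow> 'h) monoid" where
  "unitary_group = \<lparr>carrier = {U. unitary_op U}, mult = (\<circ>), one = id\<rparr>"


section \<open>Groups and representations\<close>

definition ICC :: "('g, 'm) monoid_scheme \<Rightarrow> bool" where
  "ICC G \<longleftrightarrow> (\<forall>g\<in>carrier G. g \<noteq> \<one>\<^bsub>G\<^esub> \<longrightarrow>
     infinite ((\<lambda>h. h \<otimes>\<^bsub>G\<^esub> g \<otimes>\<^bsub>G\<^esub> inv\<^bsub>G\<^esub> h) ` carrier G))"

definition unitary_rep :: "('g, 'm) monoid_scheme \<Rightarrow> ('g \<Rightarrow> 'h::chilbert \<Rightarrow> 'h) \<Rightarrow> bool" where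
  "unitary_rep G \<pi> \<longleftrightarrow> \<pi> \<in> hom G unitary_group"


section \<open>Parseval frames\<close>

text \<open>
  The inner product is a parameter, so that the notion applies both to closed subspaces of a Hilbert
  space and to finite direct sums of such subspaces.
\<close>

definition parseval_frame ::
    "('v \<Rightarrow> 'v \<Rightarrow> complex) \<Rightarrow> 'v set \<Rightarrow> 'i set \<Rightarrow> ('i \<Rightarrow> 'v) \<Rightarrow> bool" where
  "parseval_frame ip K I e \<longleftrightarrow> (\<forall>i\<in>I. e i \<in> K) \<and>
     (\<forall>f\<in>K. ((\<lambda>i. (cmod (ip f (e i)))\<^sup>2) has_sum Re (ip f f)) I)"

definition parseval_frame_vector ::
    "('g, 'm) monoid_scheme \<Rightarrow> ('g \<Rightarrow> 'h::chilbert \<Rightarrow> 'h) \<Rightarrow> 'h set \<Rightarrow> 'h \<Rightarrow> bool" where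
  "parseval_frame_vector G \<pi> K \<xi> \<longleftrightarrow>
     closed_csubspace K \<and> parseval_frame cinner K (carrier G) (\<lambda>g. \<pi> g \<xi>)"

text \<open>
  The direct sum of the subspaces \<open>K j\<close>, \<open>j \<in> J\<close> with \<open>J\<close> finite, is modelled by \<open>Pi\<^sub>E J K\<close> with
  the following inner product.
\<close>

definition dsum_cinner :: "'j set \<Rightarrow> ('j \<Rightarrow> 'h::chilbert) \<Rightarrow> ('j \<Rightarrow> 'h) \<Rightarrow> complex" where
  "dsum_cinner J f g = (\<Sum>j\<in>J. cinner (f j) (g j))"

definition strongly_disjoint ::
    "'j set \<Rightarrow> ('j \<Rightarrow> 'h::chilbert set) \<Rightarrow> 'i set \<Rightarrow> ('j \<Rightarrow> 'i \<Rightarrow> 'h) \<Rightarrow> bool" where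
  "strongly_disjoint J K I e \<longleftrightarrow>
     (\<forall>j\<in>J. parseval_frame cinner (K j) I (e j)) \<and>
     parseval_frame (dsum_cinner J) (Pi\<^sub>E J K) I (\<lambda>i. \<lambda>j\<in>J. e j i)"

end

theory Submission
  imports Defs
begin

text \<open>
  Two Parseval frame vectors for the whole space have the same norm
  (\<open>parseval_frame_vector_norm_unique\<close>), so the norm prescribed for \<open>\<xi>\<^bsub>N+1\<^esub>\<close> makes
  \<open>\<Xi> = \<xi>\<^sub>1 \<oplus> \<dots> \<oplus> \<xi>\<^bsub>N+1\<^esub>\<close> a unit vector.  By strong disjointness its orbit is a Parseval
  frame of the direct sum of \<open>N\<close> copies of the whole space and the range of \<open>p\<close>, and a Parseval frame
  of unit vectors is an orthonormal basis (\<open>orbit_orthonormal\<close>).  The theorem reads off what this says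
  about intertwining operators from the direct sum to the space.

  Such an operator is a row \<open>(u\<^sub>1, \<dots>, u\<^bsub>N+1\<^esub>)\<close> of operators in the commutant, the last one
  factoring through \<open>p\<close>, and it sends the orbit of \<open>\<Xi>\<close> to the orbit of \<open>\<eta> = u\<^sub>1 \<xi>\<^sub>1 + \<dots>\<close>.

  Existence: the map that sends the orthonormal basis to the orbit of \<open>\<eta>\<close> has the components
  \<open>u\<^sub>i f = \<Sum>\<^sub>g \<langle>f, \<pi>(g) \<xi>\<^sub>i\<rangle> \<pi>(g) \<eta>\<close>.  The sums converge because all families involved satisfy
  Bessel's inequality (\<open>bessel_synthesis_summable\<close>, \<open>coefficients_exist\<close>).

  Everything else rests on the identity \<open>\<Sum>\<^sub>g |\<langle>f, \<pi>(g) \<eta>\<rangle>|\<^sup>2 = \<Sum>\<^sub>i \<parallel>u\<^sub>i\<^sup>* f\<parallel>\<^sup>2\<close>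
  (\<open>combination_energy\<close>), which is Parseval's identity for \<open>u\<^sub>1\<^sup>* f \<oplus> \<dots> \<oplus> u\<^bsub>N+1\<^esub>\<^sup>* f\<close>.  If the
  left-hand side is zero, the adjoints vanish, whence uniqueness.  If \<open>\<eta>\<close> is a Parseval frame vector
  for the range of \<open>q\<close>, the left-hand side is \<open>\<parallel>q f\<parallel>\<^sup>2\<close>, and polarization turns this into
  \<open>\<Sum>\<^sub>i u\<^sub>i u\<^sub>i\<^sup>* = q\<close>.  Conversely, if \<open>\<Sum>\<^sub>i u\<^sub>i u\<^sub>i\<^sup>* = q\<close>, the right-hand side is \<open>\<parallel>f\<parallel>\<^sup>2\<close> for
  \<open>f\<close> in the range of \<open>q\<close>.

  The adjoints are constructed from the Parseval frame at hand (\<open>adjoint_exists\<close>) rather than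
  from the Riesz representation theorem.
\<close>

section \<open>Inner products\<close>

lemma cinner_add_right: "cinner x (y + z) = cinner x y + cinner x (z :: 'h::chilbert)"
  by (metis cinner_add_left cinner_commute complex_cnj_add)

lemma cinner_scaleC_right: "cinner x (c *\<^sub>C y) = cnj c * cinner x (y :: 'h::chilbert)"
  by (metis cinner_scaleC_left cinner_commute complex_cnj_mult)

lemma cinner_zero_left [simp]: "cinner 0 (y :: 'h::chilbert) = 0"
  using cinner_add_left[of 0 0 y] by simp

lemma cinner_zero_right [simp]: "cinner (y :: 'h::chilbert) 0 = 0"
  using cinner_add_right[of y 0 0] by simp

lemma cinner_diff_left: "cinner (x - y) z = cinner x z - cinner (y :: 'h::chilbert) z"
  using cinner_add_left[of "x - y" y z] by simp

lemma cinner_diff_right: "cinner z (x - y) = cinner z x - cinner z (y :: 'h::chilbert)"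
  using cinner_add_right[of z "x - y" y] by simp

lemma cinner_sum_left: "cinner (\<Sum>i\<in>I. f i) z = (\<Sum>i\<in>I. cinner (f i :: 'h::chilbert) z)"
  by (induction I rule: infinite_finite_induct) (simp_all add: cinner_add_left)

lemma cinner_sum_right: "cinner z (\<Sum>i\<in>I. f i) = (\<Sum>i\<in>I. cinner z (f i :: 'h::chilbert))"
  by (induction I rule: infinite_finite_induct) (simp_all add: cinner_add_right)

lemma scaleC_zero_left [simp]: "0 *\<^sub>C (x :: 'h::chilbert) = 0"
  using scaleC_of_real[of 0 x] by simp

lemma scaleC_zero_right [simp]: "c *\<^sub>C (0 :: 'h::chilbert) = 0"
  using scaleC_add_right[of c 0 "0 :: 'h"] by simp

lemma scaleC_one [simp]: "1 *\<^sub>C (x :: 'h::chilbert) = x"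
  using scaleC_of_real[of 1 x] by simp

lemma scaleC_sum_right: "c *\<^sub>C (\<Sum>i\<in>I. f i) = (\<Sum>i\<in>I. c *\<^sub>C (f i :: 'h::chilbert))"
  by (induction I rule: infinite_finite_induct) (simp_all add: scaleC_add_right)

lemma cinner_eqI:
  assumes "\<And>z. cinner z x = cinner z (y :: 'h::chilbert)"
  shows "x = y"
proof -
  have "cinner (x - y) (x - y) = 0"
    by (simp add: assms cinner_diff_right)
  then show ?thesis
    by (simp add: cinner_self)
qed

lemma norm_sq_eq_cinner: "(norm (x :: 'h::chilbert))\<^sup>2 = Re (cinner x x)"
  by (simp add: cinner_self)

lemma norm_scaleC: "norm (c *\<^sub>C (x :: 'h::chilbert)) = cmod c * norm x"
proof -
  have "complex_of_real ((norm (c *\<^sub>C x))\<^sup>2) = c * cnj c * cinner x x"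
    unfolding cinner_self[symmetric] by (simp add: cinner_scaleC_left cinner_scaleC_right)
  also have "\<dots> = complex_of_real ((cmod c * norm x)\<^sup>2)"
    unfolding cinner_self by (simp add: complex_norm_square[symmetric] power_mult_distrib)
  finally have "(norm (c *\<^sub>C x))\<^sup>2 = (cmod c * norm x)\<^sup>2"
    by (simp only: of_real_eq_iff)
  then show ?thesis
    by (rule power2_eq_imp_eq) simp_all
qed

lemma norm_diff_sq:
  "(norm (x - y))\<^sup>2 = (norm x)\<^sup>2 - 2 * Re (cinner x y) + (norm (y :: 'h::chilbert))\<^sup>2"
proof -
  have "Re (cinner y x) = Re (cinner x y)"
    by (subst cinner_commute) simp
  then show ?thesis
    by (simp add: norm_sq_eq_cinner cinner_diff_left cinner_diff_right)
qed

lemma cauchy_schwarz: "cmod (cinner x y) \<le> norm x * norm (y :: 'h::chilbert)"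
proof (cases "y = 0")
  case False
  then have pos: "(norm y)\<^sup>2 > 0" by simp
  \<comment> \<open>\<open>t *\<^sub>C y\<close> is the orthogonal projection of \<open>x\<close> to the line through \<open>y\<close>.\<close>
  define t where "t = cinner x y / complex_of_real ((norm y)\<^sup>2)"
  have t: "cmod t = cmod (cinner x y) / (norm y)\<^sup>2"
    unfolding t_def norm_divide by (simp add: norm_power)
  have "cnj t * cinner x y = complex_of_real ((cmod (cinner x y))\<^sup>2 / (norm y)\<^sup>2)"
    unfolding t_def of_real_divide complex_norm_square by simp
  then have re: "Re (cinner x (t *\<^sub>C y)) = (cmod (cinner x y))\<^sup>2 / (norm y)\<^sup>2"
    by (simp add: cinner_scaleC_right)
  have n: "(norm (t *\<^sub>C y))\<^sup>2 = (cmod (cinner x y))\<^sup>2 / (norm y)\<^sup>2"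
    using pos by (simp add: norm_scaleC t power_mult_distrib power_divide power2_eq_square)
  have "0 \<le> (norm (x - t *\<^sub>C y))\<^sup>2" by simp
  also have "\<dots> = (norm x)\<^sup>2 - (cmod (cinner x y))\<^sup>2 / (norm y)\<^sup>2"
    unfolding norm_diff_sq re n by simp
  finally have "(cmod (cinner x y))\<^sup>2 \<le> (norm x * norm y)\<^sup>2"
    using pos by (simp add: divide_simps power_mult_distrib)
  then show ?thesis
    by (rule power2_le_imp_le) simp
qed simp

lemma bounded_linear_cinner_left: "bounded_linear (\<lambda>x. cinner x (y :: 'h::chilbert))"
proof (rule bounded_linear_intro)
  fix x x' :: 'h and r :: real
  show "cinner (x + x') y = cinner x y + cinner x' y"
    by (rule cinner_add_left)
  show "cinner (r *\<^sub>R x) y = r *\<^sub>R cinner x y"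
    by (metis scaleC_of_real cinner_scaleC_left scaleR_conv_of_real)
  show "cmod (cinner x y) \<le> norm x * norm y"
    by (rule cauchy_schwarz)
qed

lemma bounded_linear_scaleC: "bounded_linear (\<lambda>x. c *\<^sub>C (x :: 'h::chilbert))"
proof (rule bounded_linear_intro)
  fix x x' :: 'h and r :: real
  show "c *\<^sub>C (x + x') = c *\<^sub>C x + c *\<^sub>C x'"
    by (rule scaleC_add_right)
  show "c *\<^sub>C (r *\<^sub>R x) = r *\<^sub>R (c *\<^sub>C x)"
    by (simp add: scaleC_of_real[symmetric] scaleC_scaleC mult.commute)
  show "norm (c *\<^sub>C x) \<le> norm x * cmod c"
    by (simp add: norm_scaleC)
qed

text \<open>
  Polarization: expanding the form at \<open>x + y\<close> and at \<open>\<i>x + y\<close> shows that the sum and the difference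
  of \<open>\<langle>D x, y\<rangle>\<close> and \<open>\<langle>D y, x\<rangle>\<close> vanish.  This is where complex scalars matter.
\<close>

lemma quadratic_form_zero:
  fixes D :: "'h::chilbert \<Rightarrow> 'h"
  assumes add: "\<And>x y. D (x + y) = D x + D y"
    and scale: "\<And>c x. D (c *\<^sub>C x) = c *\<^sub>C D x"
    and zero: "\<And>x. cinner (D x) x = 0"
  shows "D x = 0"
proof -
  have cross: "cinner (D x) y + cinner (D y) x = 0" for x y
    using zero[of "x + y"] by (simp add: add cinner_add_left cinner_add_right zero add.commute)
  have "cinner (D x) y = 0" for x y
  proof -
    have "\<i> * (cinner (D x) y - cinner (D y) x) = 0"
      using cross[of "\<i> *\<^sub>C x" y]
      by (simp add: scale cinner_scaleC_left cinner_scaleC_right algebra_simps)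
    then have "cinner (D x) y = cinner (D y) x" by simp
    with cross[of x y] show ?thesis by simp
  qed
  from this[of x "D x"] show ?thesis
    by (simp add: cinner_self)
qed

lemma bounded_clinear_simps:
  assumes "bounded_clinear T"
  shows "T (x + y) = T x + T y" "T (x - y) = T x - T y" "T (c *\<^sub>C x) = c *\<^sub>C T x"
    "T (sum f F) = (\<Sum>i\<in>F. T (f i))"
proof -
  interpret bounded_linear T
    using assms by (simp add: bounded_clinear_def)
  show "T (x + y) = T x + T y" "T (x - y) = T x - T y" "T (sum f F) = (\<Sum>i\<in>F. T (f i))"
    by (rule add diff sum)+
  show "T (c *\<^sub>C x) = c *\<^sub>C T x"
    using assms by (simp add: bounded_clinear_def)
qed

lemma is_projection_id: "is_projection (id :: 'h::chilbert \<Rightarrow> 'h)"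
  by (auto simp: is_projection_def bounded_clinear_def id_def)

lemma is_projection_fixes: "is_projection q \<Longrightarrow> x \<in> range q \<Longrightarrow> q x = x"
  by (auto simp: is_projection_def fun_eq_iff)

lemma is_projection_norm_sq:
  assumes "is_projection q"
  shows "cinner (q x) x = complex_of_real ((norm (q x))\<^sup>2)"
proof -
  have "cinner (q (q x)) x = cinner (q x) (q x)"
    using assms unfolding is_projection_def by blast
  then show ?thesis
    using is_projection_fixes[OF assms, of "q x"] by (simp add: cinner_self)
qed

lemma is_projection_norm_le:
  assumes "is_projection q"
  shows "norm (q x) \<le> norm x"
proof (cases "q x = 0")
  case False
  have "(norm (q x))\<^sup>2 = cmod (cinner (q x) x)"
    by (simp add: is_projection_norm_sq[OF assms] norm_power)
  also have "\<dots> \<le> norm (q x) * norm x"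
    by (rule cauchy_schwarz)
  finally show ?thesis
    using False by (simp add: power2_eq_square)
qed simp

lemma closed_csubspace_range_projection:
  assumes "is_projection q"
  shows "closed_csubspace (range q)"
proof -
  have q: "bounded_clinear q" "bounded_linear q"
    using assms by (simp_all add: is_projection_def bounded_clinear_def)
  have "x \<in> range q \<longleftrightarrow> q x = x" for x
  proof
    assume "q x = x"
    then show "x \<in> range q" by (rule range_eqI[OF sym])
  qed (rule is_projection_fixes[OF assms])
  then have eq: "range q = {x. q x = x}"
    by blast
  have "closed (range q)"
    unfolding eq by (rule closed_Collect_eq[OF linear_continuous_on[OF q(2)] continuous_on_id])
  moreover have "q 0 = 0"
    using q(2) by (rule linear_0[OF bounded_linear.linear])
  ultimately show ?thesis
    unfolding closed_csubspace_def by (auto simp: eq bounded_clinear_simps[OF q(1)])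
qed


section \<open>Bessel families and Parseval frames\<close>

text \<open>
  The bound is 1, as for a Parseval frame of a closed subspace, but \<open>f\<close> ranges over the whole space.
\<close>

definition bessel :: "'i set \<Rightarrow> ('i \<Rightarrow> 'h::chilbert) \<Rightarrow> bool" where
  "bessel I e \<longleftrightarrow>
     (\<forall>f F. finite F \<longrightarrow> F \<subseteq> I \<longrightarrow> (\<Sum>i\<in>F. (cmod (cinner f (e i)))\<^sup>2) \<le> (norm f)\<^sup>2)"

text \<open>The coefficients of \<open>f\<close> are those of \<open>q f\<close>, to which Parseval's identity applies.\<close>

lemma bessel_if_parseval_frame_range:
  assumes q: "is_projection q" and e: "parseval_frame cinner (range q) I e"
  shows "bessel I e"
  unfolding bessel_def
proof (intro allI impI)
  fix f F assume F: "finite F" "F \<subseteq> I"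
  have "cinner f (e i) = cinner (q f) (e i)" if "i \<in> F" for i
  proof -
    have "e i \<in> range q"
      using that F e by (auto simp: parseval_frame_def)
    then have "q (e i) = e i" by (rule is_projection_fixes[OF q])
    then show ?thesis
      using q unfolding is_projection_def by metis
  qed
  then have "(\<Sum>i\<in>F. (cmod (cinner f (e i)))\<^sup>2) = (\<Sum>i\<in>F. (cmod (cinner (q f) (e i)))\<^sup>2)"
    by (intro sum.cong) simp_all
  also have "\<dots> \<le> Re (cinner (q f) (q f))"
    using e F unfolding parseval_frame_def
    by (intro finite_sum_le_has_sum[where A = I]) auto
  also have "\<dots> = (norm (q f))\<^sup>2"
    by (rule norm_sq_eq_cinner[symmetric])
  also have "\<dots> \<le> (norm f)\<^sup>2"
    by (intro power_mono is_projection_norm_le q) simp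
  finally show "(\<Sum>i\<in>F. (cmod (cinner f (e i)))\<^sup>2) \<le> (norm f)\<^sup>2" .
qed

lemma bessel_if_parseval_frame:
  "parseval_frame cinner UNIV I e \<Longrightarrow> bessel I e"
  using bessel_if_parseval_frame_range[OF is_projection_id] by simp

text \<open>
  The synthesis map is dual to the analysis map, so it inherits the norm bound: pair the sum with
  itself and apply Cauchy-Schwarz to the coefficients.
\<close>

lemma bessel_synthesis_le:
  assumes "bessel I e" "finite F" "F \<subseteq> I"
  shows "(norm (\<Sum>i\<in>F. c i *\<^sub>C e i))\<^sup>2 \<le> (\<Sum>i\<in>F. (cmod (c i))\<^sup>2)"
proof -
  define v where "v = (\<Sum>i\<in>F. c i *\<^sub>C e i)"
  define s where "s = (\<Sum>i\<in>F. (cmod (c i))\<^sup>2)"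
  have s: "s \<ge> 0" unfolding s_def by (intro sum_nonneg) simp
  have "(norm v)\<^sup>2 = cmod (cinner v v)"
    by (simp add: cinner_self norm_power)
  also have "cinner v v = (\<Sum>i\<in>F. c i * cinner (e i) v)"
    by (subst (1) v_def) (simp add: cinner_sum_left cinner_scaleC_left)
  also have "cmod \<dots> \<le> (\<Sum>i\<in>F. cmod (c i) * cmod (cinner v (e i)))"
    by (rule sum_norm_le) (metis cinner_commute complex_mod_cnj norm_mult order_refl)
  finally have "((norm v)\<^sup>2)\<^sup>2 \<le> (\<Sum>i\<in>F. cmod (c i) * cmod (cinner v (e i)))\<^sup>2"
    by (rule power_mono) simp
  also have "\<dots> \<le> s * (\<Sum>i\<in>F. (cmod (cinner v (e i)))\<^sup>2)"
    unfolding s_def by (rule Cauchy_Schwarz_ineq_sum)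
  also have "\<dots> \<le> s * (norm v)\<^sup>2"
    using assms s by (intro mult_left_mono) (auto simp: bessel_def)
  finally have "(norm v)\<^sup>2 * (norm v)\<^sup>2 \<le> s * (norm v)\<^sup>2"
    by (simp only: power2_eq_square)
  then have "(norm v)\<^sup>2 \<le> s"
    using s mult_right_le_imp_le[of "(norm v)\<^sup>2" "(norm v)\<^sup>2" s] by (cases "v = 0") simp_all
  then show ?thesis
    unfolding v_def s_def .
qed

text \<open>
  The vectors need not be absolutely summable; square summability of the coefficients makes the net
  of finite partial sums Cauchy.
\<close>

lemma bessel_synthesis_summable:
  assumes e: "bessel I e" and c: "(\<lambda>i. (cmod (c i))\<^sup>2) summable_on I"
  shows "(\<lambda>i. c i *\<^sub>C e i) summable_on I"
proof -
  let ?S = "\<lambda>F. \<Sum>i\<in>F. c i *\<^sub>C e i" and ?s = "\<lambda>F. \<Sum>i\<in>F. (cmod (c i))\<^sup>2"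
  from c obtain L where L: "((\<lambda>i. (cmod (c i))\<^sup>2) has_sum L) I"
    by (auto simp: summable_on_def)
  have "\<exists>P. eventually P (finite_subsets_at_top I) \<and>
      (\<forall>F1 F2. P F1 \<and> P F2 \<longrightarrow> dist (?S F1) (?S F2) < \<epsilon>)" if "\<epsilon> > 0" for \<epsilon>
  proof -
    have "eventually (\<lambda>F. dist (?s F) L < (\<epsilon> / 2)\<^sup>2) (finite_subsets_at_top I)"
      using L that unfolding has_sum_def by (intro tendstoD) simp_all
    then obtain F0 where F0: "finite F0" "F0 \<subseteq> I" "dist (?s F0) L < (\<epsilon> / 2)\<^sup>2"
      unfolding eventually_finite_subsets_at_top by blast
    have close: "dist (?S F) (?S F0) < \<epsilon> / 2" if F: "finite F" "F0 \<subseteq> F" "F \<subseteq> I" for F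
    proof -
      have "(dist (?S F) (?S F0))\<^sup>2 = (norm (?S (F - F0)))\<^sup>2"
        unfolding dist_norm using F by (subst sum_diff) auto
      also have "\<dots> \<le> ?s (F - F0)"
        using F by (intro bessel_synthesis_le[OF e]) auto
      also have "\<dots> = ?s F - ?s F0"
        using F by (subst sum_diff) auto
      also have "\<dots> \<le> L - ?s F0"
        using finite_sum_le_has_sum[OF L F(1,3)] by simp
      also have "\<dots> < (\<epsilon> / 2)\<^sup>2"
        using F0(3) by (simp add: dist_real_def)
      finally show ?thesis
        by (rule power2_less_imp_less) (use \<open>\<epsilon> > 0\<close> in simp)
    qed
    have "dist (?S F1) (?S F2) < \<epsilon>"
      if "finite F1" "F0 \<subseteq> F1" "F1 \<subseteq> I" "finite F2" "F0 \<subseteq> F2" "F2 \<subseteq> I" for F1 F2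
      using dist_triangle2[of "?S F1" "?S F2" "?S F0"] close[of F1] close[of F2] that by linarith
    then show ?thesis
      using F0 unfolding eventually_finite_subsets_at_top
      by (intro exI[of _ "\<lambda>F. finite F \<and> F0 \<subseteq> F \<and> F \<subseteq> I"]) blast
  qed
  then have "cauchy_filter (filtermap ?S (finite_subsets_at_top I))"
    by (simp add: cauchy_filter_metric_filtermap)
  moreover have "complete (UNIV :: 'b set)"
    by (meson Cauchy_convergent UNIV_I complete_def convergent_def)
  ultimately obtain v where "(?S \<longlongrightarrow> v) (finite_subsets_at_top I)"
    using complete_uniform[where S = UNIV] by (force simp add: filterlim_def)
  then show ?thesis
    using summable_on_def has_sum_def by blast
qed

lemma has_sum_norm_le:
  fixes f :: "'i \<Rightarrow> 'v::real_normed_vector"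
  assumes "(f has_sum s) I" and "\<And>F. finite F \<Longrightarrow> F \<subseteq> I \<Longrightarrow> norm (sum f F) \<le> b"
  shows "norm s \<le> b"
proof (rule tendsto_upperbound)
  show "((\<lambda>F. norm (sum f F)) \<longlongrightarrow> norm s) (finite_subsets_at_top I)"
    using assms(1) unfolding has_sum_def by (rule tendsto_norm)
  show "\<forall>\<^sub>F F in finite_subsets_at_top I. norm (sum f F) \<le> b"
    using assms(2) by (intro eventually_finite_subsets_at_top_weakI)
qed simp

lemma has_sum_finite_sum:
  fixes f :: "'j \<Rightarrow> 'i \<Rightarrow> 'v::topological_comm_monoid_add"
  assumes "finite J" "\<And>j. j \<in> J \<Longrightarrow> (f j has_sum s j) I"
  shows "((\<lambda>i. \<Sum>j\<in>J. f j i) has_sum (\<Sum>j\<in>J. s j)) I"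
  using assms by (induction J rule: finite_induct) (simp_all add: has_sum_add)

text \<open>The synthesis map of \<open>e'\<close> composed with the analysis map of \<open>e\<close>.\<close>

definition mixed_frame_op :: "'i set \<Rightarrow> ('i \<Rightarrow> 'h::chilbert) \<Rightarrow> ('i \<Rightarrow> 'h) \<Rightarrow> 'h \<Rightarrow> 'h" where
  "mixed_frame_op I e e' f = (\<Sum>\<^sub>\<infinity>i\<in>I. cinner f (e i) *\<^sub>C e' i)"

lemma mixed_frame_op_has_sum:
  assumes "bessel I e" "bessel I e'"
  shows "((\<lambda>i. cinner f (e i) *\<^sub>C e' i) has_sum mixed_frame_op I e e' f) I"
proof -
  have "(\<lambda>i. (cmod (cinner f (e i)))\<^sup>2) summable_on I"
    using assms(1) unfolding bessel_def
    by (intro nonneg_bdd_above_summable_on bdd_aboveI[of _ "(norm f)\<^sup>2"]) auto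
  then show ?thesis
    unfolding mixed_frame_op_def by (intro has_sum_infsum bessel_synthesis_summable assms)
qed

lemma mixed_frame_op_norm_le:
  assumes "bessel I e" "bessel I e'"
  shows "norm (mixed_frame_op I e e' f) \<le> norm f"
proof (rule has_sum_norm_le[OF mixed_frame_op_has_sum[OF assms]])
  fix F assume F: "finite F" "F \<subseteq> I"
  have "(norm (\<Sum>i\<in>F. cinner f (e i) *\<^sub>C e' i))\<^sup>2 \<le> (\<Sum>i\<in>F. (cmod (cinner f (e i)))\<^sup>2)"
    by (rule bessel_synthesis_le[OF assms(2) F])
  also have "\<dots> \<le> (norm f)\<^sup>2"
    using assms(1) F by (simp add: bessel_def)
  finally show "norm (\<Sum>i\<in>F. cinner f (e i) *\<^sub>C e' i) \<le> norm f"
    by (rule power2_le_imp_le) simp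
qed

lemma bounded_clinear_mixed_frame_op:
  assumes "bessel I e" "bessel I e'"
  shows "bounded_clinear (mixed_frame_op I e e')"
proof -
  note sums = mixed_frame_op_has_sum[OF assms]
  have scale: "mixed_frame_op I e e' (c *\<^sub>C f) = c *\<^sub>C mixed_frame_op I e e' f" for c f
    using has_sum_bounded_linear[OF bounded_linear_scaleC[of c] sums[of f]]
    by (intro has_sum_unique[OF sums]) (simp add: cinner_scaleC_left scaleC_scaleC)
  have "bounded_linear (mixed_frame_op I e e')"
  proof (rule bounded_linear_intro[where K = 1])
    fix f f' :: 'b and r :: real
    show "mixed_frame_op I e e' (f + f') = mixed_frame_op I e e' f + mixed_frame_op I e e' f'"
      using has_sum_add[OF sums[of f] sums[of f']]
      by (intro has_sum_unique[OF sums]) (simp add: cinner_add_left scaleC_add_left)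
    show "mixed_frame_op I e e' (r *\<^sub>R f) = r *\<^sub>R mixed_frame_op I e e' f"
      using scale[of "complex_of_real r" f] by (simp add: scaleC_of_real)
    show "norm (mixed_frame_op I e e' f) \<le> norm f * 1"
      using mixed_frame_op_norm_le[OF assms] by simp
  qed
  with scale show ?thesis
    by (simp add: bounded_clinear_def)
qed

text \<open>
  The frame operator \<open>S\<close> is a contraction with \<open>\<langle>S x, x\<rangle> = \<parallel>x\<parallel>\<^sup>2\<close>, and expanding
  \<open>\<parallel>x - S x\<parallel>\<^sup>2\<close> shows that such a map is the identity.
\<close>

lemma parseval_frame_reconstruction:
  assumes "parseval_frame cinner UNIV I e"
  shows "((\<lambda>i. cinner x (e i) *\<^sub>C e i) has_sum x) I"
proof -
  have e: "bessel I e"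
    using assms by (rule bessel_if_parseval_frame)
  \<comment> \<open>\<open>y\<close> is the vector \<open>S x\<close>.\<close>
  define y where "y = mixed_frame_op I e e x"
  have y: "((\<lambda>i. cinner x (e i) *\<^sub>C e i) has_sum y) I"
    unfolding y_def by (rule mixed_frame_op_has_sum[OF e e])
  have "((\<lambda>i. Re (cinner (cinner x (e i) *\<^sub>C e i) x)) has_sum Re (cinner y x)) I"
    by (intro has_sum_Re has_sum_bounded_linear[OF bounded_linear_cinner_left y])
  moreover have "Re (cinner (cinner x (e i) *\<^sub>C e i) x) = (cmod (cinner x (e i)))\<^sup>2" for i
    unfolding cinner_scaleC_left cinner_commute[of "e i" x]
    by (simp add: complex_norm_square[symmetric])
  ultimately have "((\<lambda>i. (cmod (cinner x (e i)))\<^sup>2) has_sum Re (cinner y x)) I"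
    by simp
  moreover have "((\<lambda>i. (cmod (cinner x (e i)))\<^sup>2) has_sum (norm x)\<^sup>2) I"
    using assms by (simp add: parseval_frame_def norm_sq_eq_cinner)
  ultimately have "Re (cinner y x) = (norm x)\<^sup>2"
    by (rule has_sum_unique)
  moreover have "(norm y)\<^sup>2 \<le> (norm x)\<^sup>2"
    unfolding y_def by (intro power_mono mixed_frame_op_norm_le e) simp
  ultimately have "(norm (y - x))\<^sup>2 \<le> 0"
    by (simp add: norm_diff_sq)
  then show ?thesis
    using y by simp
qed

text \<open>
  A Parseval frame makes the adjoint explicit: \<open>T\<^sup>* y = \<Sum>\<^sub>i \<langle>y, T e\<^sub>i\<rangle> e\<^sub>i\<close>.  Its
  coefficients are square summable because their partial square sums \<open>s\<close> satisfy
  \<open>s = \<langle>T v, y\<rangle>\<close> with \<open>\<parallel>v\<parallel>\<^sup>2 \<le> s\<close>.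
\<close>

lemma adjoint_exists:
  fixes e :: "'i \<Rightarrow> 'h::chilbert" and T :: "'h \<Rightarrow> 'h"
  assumes e: "parseval_frame cinner UNIV I e" and T: "bounded_clinear T"
  shows "\<exists>S. \<forall>x y. cinner (T x) y = cinner x (S y)"
proof -
  have be: "bessel I e"
    using e by (rule bessel_if_parseval_frame)
  have Tl: "bounded_linear T"
    using T by (simp add: bounded_clinear_def)
  have "\<exists>z. \<forall>x. cinner (T x) y = cinner x z" for y
  proof -
    obtain B where B: "B \<ge> 0" "\<And>x. norm (T x) \<le> norm x * B"
      using bounded_linear.nonneg_bounded[OF Tl] by blast
    let ?c = "\<lambda>i. cinner y (T (e i))"
    have bound: "(\<Sum>i\<in>F. (cmod (?c i))\<^sup>2) \<le> (B * norm y)\<^sup>2" if F: "finite F" "F \<subseteq> I" for F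
    proof -
      define s where "s = (\<Sum>i\<in>F. (cmod (?c i))\<^sup>2)"
      define v where "v = (\<Sum>i\<in>F. ?c i *\<^sub>C e i)"
      have s: "s \<ge> 0" unfolding s_def by (intro sum_nonneg) simp
      have "cinner (T v) y = (\<Sum>i\<in>F. ?c i * cinner (T (e i)) y)"
        unfolding v_def
        by (simp add: bounded_clinear_simps[OF T] cinner_sum_left cinner_scaleC_left)
      also have "\<dots> = complex_of_real s"
        unfolding s_def of_real_sum complex_norm_square
        by (intro sum.cong refl) (metis cinner_commute)
      finally have "s = cmod (cinner (T v) y)"
        using s by simp
      also have "\<dots> \<le> norm (T v) * norm y"
        by (rule cauchy_schwarz)
      also have "\<dots> \<le> norm v * B * norm y"
        by (intro mult_right_mono B) simp
      finally have "s\<^sup>2 \<le> (norm v)\<^sup>2 * (B * norm y)\<^sup>2"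
        using s by (metis power_mono power_mult_distrib mult.assoc)
      also have "(norm v)\<^sup>2 \<le> s"
        unfolding v_def s_def by (rule bessel_synthesis_le[OF be F])
      finally have "s * s \<le> s * (B * norm y)\<^sup>2"
        by (simp add: power2_eq_square mult_right_mono)
      then show ?thesis
        unfolding s_def[symmetric] using s by (cases "s = 0") simp_all
    qed
    have "(\<lambda>i. (cmod (?c i))\<^sup>2) summable_on I"
      by (intro nonneg_bdd_above_summable_on bdd_aboveI[of _ "(B * norm y)\<^sup>2"])
        (auto intro: bound)
    then obtain z where z: "((\<lambda>i. ?c i *\<^sub>C e i) has_sum z) I"
      using bessel_synthesis_summable[OF be, of ?c] by (auto simp: summable_on_def)
    have "cinner (T x) y = cinner x z" for x
    proof -
      have "((\<lambda>i. cinner (T (cinner x (e i) *\<^sub>C e i)) y) has_sum cinner (T x) y) I"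
        by (intro has_sum_bounded_linear[OF bounded_linear_cinner_left]
            has_sum_bounded_linear[OF Tl] parseval_frame_reconstruction e)
      moreover have "((\<lambda>i. cnj (cinner (?c i *\<^sub>C e i) x)) has_sum cnj (cinner z x)) I"
        by (intro has_sum_bounded_linear[OF bounded_linear_cnj]
            has_sum_bounded_linear[OF bounded_linear_cinner_left] z)
      moreover have "cinner (T (cinner x (e i) *\<^sub>C e i)) y = cnj (cinner (?c i *\<^sub>C e i) x)" for i
        by (simp add: bounded_clinear_simps[OF T] cinner_scaleC_left cinner_commute[symmetric])
      ultimately have "cinner (T x) y = cnj (cinner z x)"
        by (simp add: has_sum_unique)
      then show ?thesis
        by (simp add: cinner_commute[symmetric])
    qed
    then show ?thesis by blast
  qed
  then show ?thesis by metis
qed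

lemma cadjoint_cinner:
  fixes e :: "'i \<Rightarrow> 'h::chilbert" and T :: "'h \<Rightarrow> 'h"
  assumes "parseval_frame cinner UNIV I e" "bounded_clinear T"
  shows "cinner (T x) y = cinner x (cadjoint T y)"
proof -
  obtain S where S: "\<forall>x y. cinner (T x) y = cinner x (S y)"
    using adjoint_exists[OF assms] by blast
  have "cadjoint T = S"
    unfolding cadjoint_def
  proof (rule the_equality[where a = S])
    fix S' assume "\<forall>x y. cinner (T x) y = cinner x (S' y)"
    with S have "cinner x (S' y) = cinner x (S y)" for x y
      by metis
    then show "S' = S"
      by (metis ext cinner_eqI)
  qed (rule S)
  with S show ?thesis by simp
qed


section \<open>Frame vectors of a unitary representation\<close>

locale unitary_representation = group G
  for G :: "('g, 'm) monoid_scheme" (structure) +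
  fixes \<pi> :: "'g \<Rightarrow> 'h::chilbert \<Rightarrow> 'h"
  assumes unitary_rep: "unitary_rep G \<pi>"
begin

lemma unitary_pi: "g \<in> carrier G \<Longrightarrow> unitary_op (\<pi> g)"
  using unitary_rep by (auto simp: unitary_rep_def unitary_group_def hom_def)

lemma bounded_clinear_pi: "g \<in> carrier G \<Longrightarrow> bounded_clinear (\<pi> g)"
  using unitary_pi by (simp add: unitary_op_def)

lemma pi_mult: "g \<in> carrier G \<Longrightarrow> h \<in> carrier G \<Longrightarrow> \<pi> (g \<otimes> h) x = \<pi> g (\<pi> h x)"
  using unitary_rep by (simp add: unitary_rep_def unitary_group_def hom_def)

lemma pi_one: "\<pi> \<one> x = x"
proof -
  obtain y where "x = \<pi> \<one> y"
    using unitary_pi[OF one_closed] by (metis unitary_op_def surjE)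
  then show ?thesis
    using pi_mult[of \<one> \<one> y] by simp
qed

lemma cinner_pi: "g \<in> carrier G \<Longrightarrow> cinner (\<pi> g x) (\<pi> g y) = cinner x y"
  using unitary_pi by (simp add: unitary_op_def)

lemma cinner_pi_shift:
  assumes "h \<in> carrier G" "g \<in> carrier G"
  shows "cinner (\<pi> h x) (\<pi> (h \<otimes> g) y) = cinner x (\<pi> g y)"
  using assms by (simp add: pi_mult cinner_pi)

lemma bij_betw_left_mult: "h \<in> carrier G \<Longrightarrow> bij_betw (\<lambda>g. h \<otimes> g) (carrier G) (carrier G)"
  by (rule bij_betwI[where g = "\<lambda>g. inv h \<otimes> g"]) (auto simp: inv_solve_left m_assoc[symmetric])

lemma bij_betw_inv: "bij_betw (\<lambda>g. inv g) (carrier G) (carrier G)"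
  by (rule bij_betwI[where g = "\<lambda>g. inv g"]) auto

text \<open>
  The coefficients of \<open>\<eta>\<close> along the orbit of \<open>\<xi>\<close> are, up to conjugation and inversion in the group,
  those of \<open>\<xi>\<close> along the orbit of \<open>\<eta>\<close>.  This replaces the usual appeal to a trace on the commutant.
\<close>

lemma parseval_frame_vector_norm_unique:
  assumes "parseval_frame_vector G \<pi> UNIV \<xi>" "parseval_frame_vector G \<pi> UNIV \<eta>"
  shows "norm \<xi> = norm \<eta>"
proof -
  have "((\<lambda>g. (cmod (cinner \<eta> (\<pi> g \<xi>)))\<^sup>2) has_sum (norm \<eta>)\<^sup>2) (carrier G)"
    using assms(1) by (simp add: parseval_frame_vector_def parseval_frame_def norm_sq_eq_cinner)
  then have "((\<lambda>g. (cmod (cinner \<eta> (\<pi> (inv g) \<xi>)))\<^sup>2) has_sum (norm \<eta>)\<^sup>2) (carrier G)"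
    by (subst has_sum_reindex_bij_betw[OF bij_betw_inv])
  moreover have "cmod (cinner \<eta> (\<pi> (inv g) \<xi>)) = cmod (cinner \<xi> (\<pi> g \<eta>))" if "g \<in> carrier G" for g
  proof -
    have "cinner \<eta> (\<pi> (inv g) \<xi>) = cinner (\<pi> g \<eta>) (\<pi> (g \<otimes> inv g) \<xi>)"
      using that by (simp only: cinner_pi_shift inv_closed)
    also have "\<dots> = cnj (cinner \<xi> (\<pi> g \<eta>))"
      using that by (simp add: pi_one cinner_commute[symmetric])
    finally show ?thesis by simp
  qed
  ultimately have "((\<lambda>g. (cmod (cinner \<xi> (\<pi> g \<eta>)))\<^sup>2) has_sum (norm \<eta>)\<^sup>2) (carrier G)"
    by (subst (asm) has_sum_cong[where g = "\<lambda>g. (cmod (cinner \<xi> (\<pi> g \<eta>)))\<^sup>2"]) auto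
  moreover have "((\<lambda>g. (cmod (cinner \<xi> (\<pi> g \<eta>)))\<^sup>2) has_sum (norm \<xi>)\<^sup>2) (carrier G)"
    using assms(2) by (simp add: parseval_frame_vector_def parseval_frame_def norm_sq_eq_cinner)
  ultimately have "(norm \<xi>)\<^sup>2 = (norm \<eta>)\<^sup>2"
    by (rule has_sum_unique[rotated])
  then show ?thesis
    by (rule power2_eq_imp_eq) simp_all
qed

text \<open>Applying \<open>\<pi> h\<close> to the sum only translates its index by \<open>h\<close>.\<close>

lemma mixed_frame_op_commutant:
  assumes "bessel (carrier G) (\<lambda>g. \<pi> g \<xi>)" "bessel (carrier G) (\<lambda>g. \<pi> g \<eta>)"
  shows "mixed_frame_op (carrier G) (\<lambda>g. \<pi> g \<xi>) (\<lambda>g. \<pi> g \<eta>) \<in> commutant (\<pi> ` carrier G)"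
proof -
  define u where "u = mixed_frame_op (carrier G) (\<lambda>g. \<pi> g \<xi>) (\<lambda>g. \<pi> g \<eta>)"
  have sums: "((\<lambda>g. cinner f (\<pi> g \<xi>) *\<^sub>C \<pi> g \<eta>) has_sum u f) (carrier G)" for f
    unfolding u_def by (rule mixed_frame_op_has_sum[OF assms])
  have "u (\<pi> h f) = \<pi> h (u f)" if h: "h \<in> carrier G" for h f
  proof -
    have "bounded_linear (\<pi> h)"
      using bounded_clinear_pi[OF h] by (simp add: bounded_clinear_def)
    then have "((\<lambda>g. \<pi> h (cinner f (\<pi> g \<xi>) *\<^sub>C \<pi> g \<eta>)) has_sum \<pi> h (u f)) (carrier G)"
      by (rule has_sum_bounded_linear[OF _ sums])
    moreover have "\<pi> h (cinner f (\<pi> g \<xi>) *\<^sub>C \<pi> g \<eta>) =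
        cinner (\<pi> h f) (\<pi> (h \<otimes> g) \<xi>) *\<^sub>C \<pi> (h \<otimes> g) \<eta>" if "g \<in> carrier G" for g
      using h that by (simp add: bounded_clinear_simps(3)[OF bounded_clinear_pi[OF h]] pi_mult cinner_pi)
    ultimately have "((\<lambda>g. cinner (\<pi> h f) (\<pi> (h \<otimes> g) \<xi>) *\<^sub>C \<pi> (h \<otimes> g) \<eta>) has_sum \<pi> h (u f))
        (carrier G)"
      by (simp cong: has_sum_cong)
    then have "((\<lambda>g. cinner (\<pi> h f) (\<pi> g \<xi>) *\<^sub>C \<pi> g \<eta>) has_sum \<pi> h (u f)) (carrier G)"
      by (rule has_sum_reindex_bij_betw[OF bij_betw_left_mult[OF h], THEN iffD1])
    with sums show ?thesis
      by (rule has_sum_unique)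
  qed
  moreover have "bounded_clinear u"
    unfolding u_def by (rule bounded_clinear_mixed_frame_op[OF assms])
  ultimately show ?thesis
    unfolding u_def[symmetric] commutant_def by (auto simp: fun_eq_iff)
qed

end


section \<open>Tuples of frame vectors that span a full orthonormal basis\<close>

text \<open>
  The frame vector \<open>\<zeta>\<close> provides the adjoints of operators in the commutant.  The norm condition
  says that the vector with components \<open>\<xi> j\<close> in the direct sum of the spaces \<open>range (p j)\<close> is a unit vector; since strong
  disjointness makes its orbit a Parseval frame, the orbit is then an orthonormal basis.
\<close>

locale complete_frame_tuple = unitary_representation G \<pi>
  for G :: "('g, 'm) monoid_scheme" (structure) and \<pi> :: "'g \<Rightarrow> 'h::chilbert \<Rightarrow> 'h" +
  fixes \<zeta> :: 'h and J :: "'j set" and p :: "'j \<Rightarrow> 'h \<Rightarrow> 'h" and \<xi> :: "'j \<Rightarrow> 'h"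
  assumes frame_vector: "parseval_frame_vector G \<pi> UNIV \<zeta>"
    and finite_J: "finite J"
    and projection: "\<And>j. j \<in> J \<Longrightarrow> is_projection (p j)"
    and disjoint: "strongly_disjoint J (\<lambda>j. range (p j)) (carrier G) (\<lambda>j g. \<pi> g (\<xi> j))"
    and unit_norm: "(\<Sum>j\<in>J. (norm (\<xi> j))\<^sup>2) = 1"
begin

lemma cinner_cadjoint_right:
  assumes "T \<in> commutant (\<pi> ` carrier G)"
  shows "cinner x (cadjoint T y) = cinner (T x) y"
  using assms frame_vector cadjoint_cinner[of "carrier G" "\<lambda>g. \<pi> g \<zeta>" T x y]
  by (simp add: commutant_def parseval_frame_vector_def)

lemma cinner_cadjoint_left:
  assumes "T \<in> commutant (\<pi> ` carrier G)"
  shows "cinner (cadjoint T y) x = cinner y (T x)"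
  using cinner_cadjoint_right[OF assms, of x y] by (metis cinner_commute)

lemma orbit_in_range:
  assumes "j \<in> J" "g \<in> carrier G"
  shows "\<pi> g (\<xi> j) \<in> range (p j)"
  using disjoint assms by (simp add: strongly_disjoint_def parseval_frame_def)

lemma bessel_orbit: "j \<in> J \<Longrightarrow> bessel (carrier G) (\<lambda>g. \<pi> g (\<xi> j))"
  using disjoint projection
  by (intro bessel_if_parseval_frame_range[where q = "p j"]) (simp_all add: strongly_disjoint_def)

lemma direct_sum_parseval:
  assumes "\<And>j. j \<in> J \<Longrightarrow> f j \<in> range (p j)"
  shows "((\<lambda>g. (cmod (\<Sum>j\<in>J. cinner (f j) (\<pi> g (\<xi> j))))\<^sup>2) has_sum (\<Sum>j\<in>J. (norm (f j))\<^sup>2))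
    (carrier G)"
proof -
  have "restrict f J \<in> (\<Pi>\<^sub>E j\<in>J. range (p j))"
    using assms by auto
  then have "((\<lambda>g. (cmod (dsum_cinner J (restrict f J) (\<lambda>j\<in>J. \<pi> g (\<xi> j))))\<^sup>2) has_sum
      Re (dsum_cinner J (restrict f J) (restrict f J))) (carrier G)"
    using disjoint unfolding strongly_disjoint_def parseval_frame_def by blast
  then show ?thesis
    by (simp add: dsum_cinner_def norm_sq_eq_cinner)
qed

text \<open>
  A unit vector in a Parseval frame is orthogonal to all the other frame vectors, because its own
  coefficient already exhausts its norm.
\<close>

lemma orbit_orthonormal:
  assumes g: "g \<in> carrier G"
  shows "(\<Sum>j\<in>J. cinner (\<xi> j) (\<pi> g (\<xi> j))) = (if g = \<one> then 1 else 0)"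
proof -
  let ?c = "\<lambda>g. \<Sum>j\<in>J. cinner (\<xi> j) (\<pi> g (\<xi> j))"
  have one: "?c \<one> = 1"
    using arg_cong[OF unit_norm, of complex_of_real] by (simp add: pi_one cinner_self)
  have "((\<lambda>g. (cmod (?c g))\<^sup>2) has_sum 1) (carrier G)"
    using direct_sum_parseval[of \<xi>] orbit_in_range[OF _ one_closed] by (simp add: pi_one unit_norm)
  then have "(\<Sum>h\<in>{\<one>, g}. (cmod (?c h))\<^sup>2) \<le> 1"
    using g by (intro finite_sum_le_has_sum[where A = "carrier G"]) auto
  then show ?thesis
    using one by (cases "g = \<one>") auto
qed

text \<open>
  The intertwining operators from the direct sum of the spaces \<open>range (p j)\<close> to the whole space, given
  by their components; each component is extended by zero to the orthogonal complement of \<open>range (p j)\<close>.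
\<close>

definition coefficients :: "('j \<Rightarrow> 'h \<Rightarrow> 'h) \<Rightarrow> bool" where
  "coefficients u \<longleftrightarrow> (\<forall>j\<in>J. u j \<in> commutant (\<pi> ` carrier G) \<and> u j \<circ> p j = u j)"

lemma pi_combination:
  assumes "coefficients u" "g \<in> carrier G"
  shows "\<pi> g (\<Sum>j\<in>J. u j (\<xi> j)) = (\<Sum>j\<in>J. u j (\<pi> g (\<xi> j)))"
  using assms
  by (auto simp: bounded_clinear_simps(4)[OF bounded_clinear_pi[OF assms(2)]]
      coefficients_def commutant_def fun_eq_iff intro!: sum.cong)

text \<open>Taking adjoints in \<open>u j \<circ> p j = u j\<close> gives \<open>p j \<circ> (u j)\<^sup>* = (u j)\<^sup>*\<close>.\<close>

lemma cadjoint_in_range: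
  assumes "coefficients u" "j \<in> J"
  shows "cadjoint (u j) f \<in> range (p j)"
proof -
  have u: "u j \<in> commutant (\<pi> ` carrier G)" "\<And>x. u j (p j x) = u j x"
    using assms by (auto simp: coefficients_def fun_eq_iff)
  have "cinner x (p j (cadjoint (u j) f)) = cinner x (cadjoint (u j) f)" for x
  proof -
    have "cinner x (p j (cadjoint (u j) f)) = cinner (p j x) (cadjoint (u j) f)"
      using projection[OF assms(2)] by (simp add: is_projection_def)
    then show ?thesis
      by (simp add: cinner_cadjoint_right[OF u(1)] u(2))
  qed
  then have "p j (cadjoint (u j) f) = cadjoint (u j) f"
    by (rule cinner_eqI)
  then show ?thesis
    by (metis rangeI)
qed

lemma cinner_pi_combination:
  assumes "coefficients u" "g \<in> carrier G"
  shows "cinner f (\<pi> g (\<Sum>j\<in>J. u j (\<xi> j))) = (\<Sum>j\<in>J. cinner (cadjoint (u j) f) (\<pi> g (\<xi> j)))"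
  using assms(1) unfolding pi_combination[OF assms] cinner_sum_right
  by (intro sum.cong) (simp_all add: cinner_cadjoint_left coefficients_def)

text \<open>
  The key identity: the coefficients of \<open>f\<close> along the orbit of \<open>\<Sum>j\<in>J. u j (\<xi> j)\<close> are those of
  the vector with components \<open>(u j)\<^sup>* f\<close> along the orbit of the tuple, so Parseval's identity in the
  direct sum computes their square sum.
\<close>

lemma combination_energy:
  assumes u: "coefficients u"
  shows "((\<lambda>g. (cmod (cinner f (\<pi> g (\<Sum>j\<in>J. u j (\<xi> j)))))\<^sup>2) has_sum
    (\<Sum>j\<in>J. (norm (cadjoint (u j) f))\<^sup>2)) (carrier G)"
  using direct_sum_parseval[of "\<lambda>j. cadjoint (u j) f", OF cadjoint_in_range[OF u]]
  by (simp add: cinner_pi_combination[OF u] cong: has_sum_cong)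

lemma cinner_sum_comp_cadjoint:
  assumes "coefficients u"
  shows "cinner (\<Sum>j\<in>J. (u j \<circ> cadjoint (u j)) f) f =
    complex_of_real (\<Sum>j\<in>J. (norm (cadjoint (u j) f))\<^sup>2)"
  using assms unfolding cinner_sum_left of_real_sum
  by (intro sum.cong refl)
    (simp add: cinner_self[symmetric] cinner_cadjoint_right coefficients_def del: of_real_power)

text \<open>
  If \<open>u\<close> and \<open>v\<close> give the same vector, then the vector with components \<open>(u j)\<^sup>* f - (v j)\<^sup>* f\<close> of the
  direct sum is orthogonal to the orbit of the tuple, hence zero.
\<close>

lemma coefficients_unique:
  assumes u: "coefficients u" and v: "coefficients v"
    and eq: "(\<Sum>j\<in>J. u j (\<xi> j)) = (\<Sum>j\<in>J. v j (\<xi> j))" and j: "j \<in> J"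
  shows "u j = v j"
proof -
  have "cadjoint (u j) f = cadjoint (v j) f" for f
  proof -
    let ?d = "\<lambda>j. cadjoint (u j) f - cadjoint (v j) f"
    have "?d j \<in> range (p j)" if "j \<in> J" for j
    proof -
      have "p j (?d j) = ?d j"
        using projection[OF that]
          is_projection_fixes[OF projection[OF that] cadjoint_in_range[OF u that, of f]]
          is_projection_fixes[OF projection[OF that] cadjoint_in_range[OF v that, of f]]
        by (simp add: is_projection_def bounded_clinear_simps(2))
      then show ?thesis by (metis rangeI)
    qed
    note direct_sum_parseval[of ?d, OF this]
    moreover have "(\<Sum>j\<in>J. cinner (?d j) (\<pi> g (\<xi> j))) = 0" if "g \<in> carrier G" for g
      using cinner_pi_combination[OF u that, of f] cinner_pi_combination[OF v that, of f]
      by (simp add: cinner_diff_left sum_subtractf eq)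
    ultimately have "((\<lambda>g. 0) has_sum (\<Sum>j\<in>J. (norm (?d j))\<^sup>2)) (carrier G)"
      by (simp cong: has_sum_cong)
    then have "(\<Sum>j\<in>J. (norm (?d j))\<^sup>2) = 0"
      by (rule has_sum_unique[OF _ has_sum_0_simp])
    then show ?thesis
      using finite_J j by (simp add: sum_nonneg_eq_0_iff)
  qed
  moreover have "u j \<in> commutant (\<pi> ` carrier G)" "v j \<in> commutant (\<pi> ` carrier G)"
    using u v j by (simp_all add: coefficients_def)
  ultimately have "cinner y (u j x) = cinner y (v j x)" for x y
    by (metis cinner_cadjoint_left)
  then show ?thesis
    by (metis ext cinner_eqI)
qed

text \<open>
  The coefficient operators of \<open>\<eta>\<close> send \<open>f\<close> to the synthesis, along the orbit of \<open>\<eta>\<close>, of its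
  coefficients along the orbit of \<open>\<xi> j\<close>.  At the vectors \<open>\<xi> j\<close> these coefficients add up to the
  Kronecker delta at the identity.
\<close>

lemma coefficients_exist:
  assumes q: "is_projection q" and \<eta>: "parseval_frame_vector G \<pi> (range q) \<eta>"
  shows "\<exists>u. coefficients u \<and> (\<forall>j\<in>J. q \<circ> u j = u j) \<and> \<eta> = (\<Sum>j\<in>J. u j (\<xi> j))"
proof -
  define u where "u j = mixed_frame_op (carrier G) (\<lambda>g. \<pi> g (\<xi> j)) (\<lambda>g. \<pi> g \<eta>)" for j
  have b\<eta>: "bessel (carrier G) (\<lambda>g. \<pi> g \<eta>)"
    using \<eta> by (intro bessel_if_parseval_frame_range[OF q]) (simp add: parseval_frame_vector_def)
  have sums: "((\<lambda>g. cinner f (\<pi> g (\<xi> j)) *\<^sub>C \<pi> g \<eta>) has_sum u j f) (carrier G)"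
    if "j \<in> J" for j f
    unfolding u_def by (rule mixed_frame_op_has_sum[OF bessel_orbit[OF that] b\<eta>])
  have "u j \<in> commutant (\<pi> ` carrier G)" if "j \<in> J" for j
    unfolding u_def by (rule mixed_frame_op_commutant[OF bessel_orbit[OF that] b\<eta>])
  moreover have "u j (p j f) = u j f" if j: "j \<in> J" for j f
  proof -
    have "cinner (p j f) (\<pi> g (\<xi> j)) = cinner f (\<pi> g (\<xi> j))" if "g \<in> carrier G" for g
      using is_projection_fixes[OF projection[OF j] orbit_in_range[OF j that]] projection[OF j]
      by (simp add: is_projection_def)
    with sums[OF j, of "p j f"]
    have "((\<lambda>g. cinner f (\<pi> g (\<xi> j)) *\<^sub>C \<pi> g \<eta>) has_sum u j (p j f)) (carrier G)"
      by (simp cong: has_sum_cong)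
    then show ?thesis
      using sums[OF j] by (rule has_sum_unique)
  qed
  moreover have "q (u j f) = u j f" if j: "j \<in> J" for j f
  proof -
    have ql: "bounded_linear q" and qc: "bounded_clinear q"
      using q by (simp_all add: is_projection_def bounded_clinear_def)
    have "q (cinner f (\<pi> g (\<xi> j)) *\<^sub>C \<pi> g \<eta>) = cinner f (\<pi> g (\<xi> j)) *\<^sub>C \<pi> g \<eta>"
      if "g \<in> carrier G" for g
      using \<eta> that is_projection_fixes[OF q, of "\<pi> g \<eta>"]
      by (simp add: bounded_clinear_simps(3)[OF qc] parseval_frame_vector_def parseval_frame_def)
    with has_sum_bounded_linear[OF ql sums[OF j, of f]]
    have "((\<lambda>g. cinner f (\<pi> g (\<xi> j)) *\<^sub>C \<pi> g \<eta>) has_sum q (u j f)) (carrier G)"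
      by (simp cong: has_sum_cong)
    then show ?thesis
      using sums[OF j] by (rule has_sum_unique)
  qed
  moreover have "\<eta> = (\<Sum>j\<in>J. u j (\<xi> j))"
  proof -
    have "((\<lambda>g. \<Sum>j\<in>J. cinner (\<xi> j) (\<pi> g (\<xi> j)) *\<^sub>C \<pi> g \<eta>) has_sum (\<Sum>j\<in>J. u j (\<xi> j)))
        (carrier G)"
      by (intro has_sum_finite_sum finite_J sums)
    moreover have "(\<Sum>j\<in>J. cinner (\<xi> j) (\<pi> g (\<xi> j)) *\<^sub>C \<pi> g \<eta>) = (if g = \<one> then \<eta> else 0)"
      if "g \<in> carrier G" for g
    proof -
      have "(\<Sum>j\<in>J. cinner (\<xi> j) (\<pi> g (\<xi> j)) *\<^sub>C \<pi> g \<eta>) =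
          (\<Sum>j\<in>J. cinner (\<xi> j) (\<pi> g (\<xi> j))) *\<^sub>C \<pi> g \<eta>"
        using finite_J by (induction J rule: finite_induct) (simp_all add: scaleC_add_left)
      then show ?thesis
        by (simp add: orbit_orthonormal[OF that] pi_one)
    qed
    ultimately have "((\<lambda>g. if g = \<one> then \<eta> else 0) has_sum (\<Sum>j\<in>J. u j (\<xi> j))) (carrier G)"
      by (simp cong: has_sum_cong)
    moreover have "((\<lambda>g. if g = \<one> then \<eta> else 0) has_sum \<eta>) (carrier G)"
      using has_sum_cong_neutral[of "carrier G" "{\<one>}" "\<lambda>g. if g = \<one> then \<eta> else 0" "\<lambda>_. \<eta>" \<eta>]
        has_sum_finite[of "{\<one>}" "\<lambda>_. \<eta>"] by auto
    ultimately show ?thesis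
      using has_sum_unique by blast
  qed
  ultimately show ?thesis
    by (intro exI[of _ u]) (auto simp: coefficients_def fun_eq_iff)
qed

text \<open>
  For a Parseval frame vector of \<open>range q\<close> the square sum of the coefficients of \<open>x\<close> is
  \<open>\<parallel>q x\<parallel>\<^sup>2 = \<langle>q x, x\<rangle>\<close>, so both sides have the same quadratic form.
\<close>

lemma sum_comp_cadjoint_eq_projection:
  assumes q: "is_projection q" and u: "coefficients u" and \<eta>: "\<eta> = (\<Sum>j\<in>J. u j (\<xi> j))"
    and frame: "parseval_frame_vector G \<pi> (range q) \<eta>"
  shows "(\<lambda>x. \<Sum>j\<in>J. (u j \<circ> cadjoint (u j)) x) = q"
proof -
  define D where "D x = (\<Sum>j\<in>J. (u j \<circ> cadjoint (u j)) x) - q x" for x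
  have uc: "u j \<in> commutant (\<pi> ` carrier G)" "bounded_clinear (u j)" if "j \<in> J" for j
    using u that by (auto simp: coefficients_def commutant_def)
  have qc: "bounded_clinear q"
    using q by (simp add: is_projection_def)
  have cadjoint_add: "cadjoint (u j) (x + y) = cadjoint (u j) x + cadjoint (u j) y"
    if "j \<in> J" for j x y
    by (rule cinner_eqI) (simp add: cinner_cadjoint_right uc(1)[OF that] cinner_add_right)
  have cadjoint_scale: "cadjoint (u j) (c *\<^sub>C x) = c *\<^sub>C cadjoint (u j) x" if "j \<in> J" for j c x
    by (rule cinner_eqI) (simp add: cinner_cadjoint_right uc(1)[OF that] cinner_scaleC_right)
  have "D x = 0" for x
  proof (rule quadratic_form_zero[where D = D])
    fix x y :: 'h and c :: complex
    show "D (x + y) = D x + D y"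
      unfolding D_def
      by (simp add: cadjoint_add bounded_clinear_simps(1)[OF qc] bounded_clinear_simps(1)[OF uc(2)]
          sum.distrib)
    show "D (c *\<^sub>C x) = c *\<^sub>C D x"
      using scaleC_add_right[of c "D x" "q x"] unfolding D_def
      by (simp add: cadjoint_scale bounded_clinear_simps(3)[OF qc] bounded_clinear_simps(3)[OF uc(2)]
          scaleC_sum_right)
    have "cinner x (\<pi> g \<eta>) = cinner (q x) (\<pi> g \<eta>)" if "g \<in> carrier G" for g
    proof -
      have "q (\<pi> g \<eta>) = \<pi> g \<eta>"
        using frame that
        by (intro is_projection_fixes[OF q]) (simp add: parseval_frame_vector_def parseval_frame_def)
      then show ?thesis
        using q unfolding is_projection_def by metis
    qed
    moreover have "((\<lambda>g. (cmod (cinner (q x) (\<pi> g \<eta>)))\<^sup>2) has_sum (norm (q x))\<^sup>2) (carrier G)"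
      using frame by (simp add: parseval_frame_vector_def parseval_frame_def norm_sq_eq_cinner)
    ultimately have "((\<lambda>g. (cmod (cinner x (\<pi> g \<eta>)))\<^sup>2) has_sum (norm (q x))\<^sup>2) (carrier G)"
      by (simp cong: has_sum_cong)
    then have "(\<Sum>j\<in>J. (norm (cadjoint (u j) x))\<^sup>2) = (norm (q x))\<^sup>2"
      using combination_energy[OF u] unfolding \<eta> by (rule has_sum_unique[rotated])
    then show "cinner (D x) x = 0"
      unfolding D_def cinner_diff_left cinner_sum_comp_cadjoint[OF u] is_projection_norm_sq[OF q]
      by simp
  qed
  then show ?thesis
    by (auto simp: D_def fun_eq_iff)
qed

text \<open>
  On \<open>range q\<close> the quadratic form of the sum is \<open>\<parallel>f\<parallel>\<^sup>2\<close>, so the key identity becomes Parseval's.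
\<close>

lemma parseval_frame_vector_combination:
  assumes q: "is_projection q" and u: "coefficients u" and qu: "\<And>j. j \<in> J \<Longrightarrow> q \<circ> u j = u j"
    and sum: "(\<lambda>x. \<Sum>j\<in>J. (u j \<circ> cadjoint (u j)) x) = q"
  shows "parseval_frame_vector G \<pi> (range q) (\<Sum>j\<in>J. u j (\<xi> j))"
proof -
  let ?\<eta> = "\<Sum>j\<in>J. u j (\<xi> j)"
  have "\<pi> g ?\<eta> \<in> range q" if "g \<in> carrier G" for g
  proof -
    have "bounded_clinear q"
      using q by (simp add: is_projection_def)
    moreover have "q (u j x) = u j x" if "j \<in> J" for j x
      using qu[OF that] by (simp add: fun_eq_iff)
    ultimately have "q (\<pi> g ?\<eta>) = \<pi> g ?\<eta>"
      by (simp add: pi_combination[OF u that] bounded_clinear_simps(4))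
    then show ?thesis by (metis rangeI)
  qed
  moreover have "((\<lambda>g. (cmod (cinner f (\<pi> g ?\<eta>)))\<^sup>2) has_sum Re (cinner f f)) (carrier G)"
    if "f \<in> range q" for f
  proof -
    have "cinner f f = complex_of_real (\<Sum>j\<in>J. (norm (cadjoint (u j) f))\<^sup>2)"
      using cinner_sum_comp_cadjoint[OF u, of f] fun_cong[OF sum, of f]
        is_projection_fixes[OF q that] by simp
    then show ?thesis
      using combination_energy[OF u, of f] by simp
  qed
  ultimately show ?thesis
    unfolding parseval_frame_vector_def parseval_frame_def
    using closed_csubspace_range_projection[OF q] by blast
qed

end


section \<open>Representing frame vectors by operators in the commutant\<close>

theorem theorem2p6:
  fixes G :: "('g, 'm) monoid_scheme"
    and \<pi> :: "'g \<Rightarrow> 'h::chilbert \<Rightarrow> 'h"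
    and \<xi> :: "nat \<Rightarrow> 'h"
    and N :: nat
    and p :: "'h \<Rightarrow> 'h"
  assumes "group G" and "countable (carrier G)" and "ICC G"
    and "unitary_rep G \<pi>"
    and "(UNIV :: 'h set) \<noteq> {0}"
    and "parseval_frame_vector G \<pi> UNIV (\<xi> 1)"
    and "N = nat \<lfloor>1 / (norm (\<xi> 1))\<^sup>2\<rfloor>"
    and "\<forall>i\<in>{1..N}. parseval_frame_vector G \<pi> UNIV (\<xi> i)"
    and "(norm (\<xi> (N + 1)))\<^sup>2 = 1 - real N * (norm (\<xi> 1))\<^sup>2"
    and "p \<in> commutant (\<pi> ` carrier G)" and "is_projection p"
    and "parseval_frame_vector G \<pi> (range p) (\<xi> (N + 1))"
    and "strongly_disjoint {1..N + 1} (\<lambda>i. if i \<le> N then UNIV else range p)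
           (carrier G) (\<lambda>i g. \<pi> g (\<xi> i))"
  shows
    "(\<forall>\<eta> K q. parseval_frame_vector G \<pi> K \<eta> \<and> is_projection q \<and> range q = K \<longrightarrow>
        (\<exists>!u. u \<in> {1..N + 1} \<rightarrow>\<^sub>E commutant (\<pi> ` carrier G) \<and>
              (\<forall>i\<in>{1..N + 1}. q \<circ> u i = u i) \<and> u (N + 1) \<circ> p = u (N + 1) \<and>
              \<eta> = (\<Sum>i\<in>{1..N + 1}. u i (\<xi> i))) \<and>
        (\<forall>u. u \<in> {1..N + 1} \<rightarrow> commutant (\<pi> ` carrier G) \<and>
              (\<forall>i\<in>{1..N + 1}. q \<circ> u i = u i) \<and> u (N + 1) \<circ> p = u (N + 1) \<and>
              \<eta> = (\<Sum>i\<in>{1..N + 1}. u i (\<xi> i)) \<longrightarrow>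
              (\<lambda>x. \<Sum>i\<in>{1..N + 1}. (u i \<circ> cadjoint (u i)) x) = q)) \<and>
     (\<forall>q u \<eta>. q \<in> commutant (\<pi> ` carrier G) \<and> is_projection q \<and>
        u \<in> {1..N + 1} \<rightarrow> commutant (\<pi> ` carrier G) \<and>
        (\<forall>i\<in>{1..N + 1}. q \<circ> u i = u i) \<and> u (N + 1) \<circ> p = u (N + 1) \<and>
        \<eta> = (\<Sum>i\<in>{1..N + 1}. u i (\<xi> i)) \<and>
        (\<lambda>x. \<Sum>i\<in>{1..N + 1}. (u i \<circ> cadjoint (u i)) x) = q \<longrightarrow>
        parseval_frame_vector G \<pi> (range q) \<eta>)"
proof -
  let ?J = "{1..N + 1}" and ?C = "commutant (\<pi> ` carrier G)"
  \<comment> \<open>With \<open>id\<close> as projection for \<open>i \<le> N\<close>, all components have the same form.\<close>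
  define P where "P i = (if i \<le> N then id else p)" for i :: nat
  interpret unitary_representation G \<pi>
    using assms(1,4) by (simp add: unitary_representation_def unitary_representation_axioms_def)
  have "(\<Sum>i\<in>{1..N}. (norm (\<xi> i))\<^sup>2) = (\<Sum>i\<in>{1..N}. (norm (\<xi> 1))\<^sup>2)"
    using parseval_frame_vector_norm_unique[OF _ assms(6)] assms(8) by (intro sum.cong refl) metis
  then have norms: "(\<Sum>i\<in>?J. (norm (\<xi> i))\<^sup>2) = 1"
    using assms(9) by simp
  have ranges: "(\<lambda>i. if i \<le> N then UNIV else range p) = (\<lambda>i. range (P i))"
    by (auto simp: P_def fun_eq_iff)
  interpret complete_frame_tuple G \<pi> "\<xi> 1" ?J P \<xi>
  proof
    show "is_projection (P i)" if "i \<in> ?J" for i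
      using assms(11) by (simp add: P_def is_projection_id)
  qed (use assms(6,13) norms in \<open>simp_all only: ranges finite_atLeastAtMost\<close>)
  have coeffs: "coefficients u \<longleftrightarrow> u \<in> ?J \<rightarrow> ?C \<and> u (N + 1) \<circ> p = u (N + 1)" for u
  proof -
    have "?J = insert (N + 1) {1..N}"
      by auto
    then show ?thesis
      unfolding coefficients_def P_def by (auto simp: Pi_iff)
  qed
  show ?thesis
  proof (intro conjI allI impI; elim conjE)
    fix \<eta> K q
    assume frame: "parseval_frame_vector G \<pi> K \<eta>" and q: "is_projection q" and K: "range q = K"
    obtain u where u: "coefficients u" "\<forall>i\<in>?J. q \<circ> u i = u i" "\<eta> = (\<Sum>i\<in>?J. u i (\<xi> i))"
      using coefficients_exist[OF q] frame K by blast
    show "\<exists>!u. u \<in> ?J \<rightarrow>\<^sub>E ?C \<and> (\<forall>i\<in>?J. q \<circ> u i = u i) \<and>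
        u (N + 1) \<circ> p = u (N + 1) \<and> \<eta> = (\<Sum>i\<in>?J. u i (\<xi> i))"
    proof (rule ex1I[of _ "restrict u ?J"])
      show "restrict u ?J \<in> ?J \<rightarrow>\<^sub>E ?C \<and> (\<forall>i\<in>?J. q \<circ> restrict u ?J i = restrict u ?J i) \<and>
          restrict u ?J (N + 1) \<circ> p = restrict u ?J (N + 1) \<and>
          \<eta> = (\<Sum>i\<in>?J. restrict u ?J i (\<xi> i))"
        using u unfolding coeffs by auto
    next
      fix v
      assume v: "v \<in> ?J \<rightarrow>\<^sub>E ?C \<and> (\<forall>i\<in>?J. q \<circ> v i = v i) \<and>
          v (N + 1) \<circ> p = v (N + 1) \<and> \<eta> = (\<Sum>i\<in>?J. v i (\<xi> i))"
      then have "coefficients v"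
        unfolding coeffs by (auto simp: PiE_def)
      then have "v i = u i" if "i \<in> ?J" for i
        using u v that by (intro coefficients_unique[of v u]) auto
      then show "v = restrict u ?J"
        using v by (auto simp: fun_eq_iff PiE_def extensional_def)
    qed
  next
    fix \<eta> K q u
    assume frame: "parseval_frame_vector G \<pi> K \<eta>" and q: "is_projection q" and K: "range q = K"
      and u: "u \<in> ?J \<rightarrow> ?C" "u (N + 1) \<circ> p = u (N + 1)"
      and \<eta>: "\<eta> = (\<Sum>i\<in>?J. u i (\<xi> i))"
    show "(\<lambda>x. \<Sum>i\<in>?J. (u i \<circ> cadjoint (u i)) x) = q"
      using frame K
      by (intro sum_comp_cadjoint_eq_projection[OF q coeffs[THEN iffD2, OF conjI[OF u]] \<eta>]) simp
  next
    fix q u \<eta>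
    assume q: "is_projection q" and u: "u \<in> ?J \<rightarrow> ?C" "u (N + 1) \<circ> p = u (N + 1)"
      and qu: "\<forall>i\<in>?J. q \<circ> u i = u i" and \<eta>: "\<eta> = (\<Sum>i\<in>?J. u i (\<xi> i))"
      and sum: "(\<lambda>x. \<Sum>i\<in>?J. (u i \<circ> cadjoint (u i)) x) = q"
    show "parseval_frame_vector G \<pi> (range q) \<eta>"
      unfolding \<eta>
      by (rule parseval_frame_vector_combination[OF q coeffs[THEN iffD2, OF conjI[OF u]] _ sum])
        (rule qu[rule_format])
  qed
qed

end
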